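(* Let $\mathbf{W}$ be an $N_1\times N_2$ random matrix whose entries are i.i.d. with density $\alpha w_m^{\alpha}w^{-(\alpha+1)}$ on $[w_m,\infty)$, where $\alpha>0$ and $w_m>0$. Let $\tau>w_m$ and let $\mathbf{B}$ be the matrix with entries $\mathbf{B}_{k,l}=\mathbf{W}_{k,l}\mathbb{1}[\mathbf{W}_{k,l}>\tau]$. Let $n=N_1\times N_2$, let $p=w_m^{\alpha}\tau^{-\alpha}$ (the probability that a given entry of $\mathbf{B}$ is non-zero), let $X$ be the number of non-zero entries of $\mathbf{B}$, and let $k\le n$ be a chosen sparsity threshold. If $k>np$, then $$\mathbb{P}(X\ge k)\le\left(\frac{n w_m^{\alpha}\tau^{-\alpha}}{k}\right)^{k}\left(\frac{1-w_m^{\alpha}\tau^{-\alpha}}{1-\frac{k}{n}}\right)^{n-k}.$$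
   Context: For $k=n$ the second factor on the right-hand side is read as $1$. *)

theory Defs
  imports "HOL-Probability.Probability"
begin

definition pareto_density :: "real \<Rightarrow> real \<Rightarrow> real \<Rightarrow> real" where
  "pareto_density \<alpha> w\<^sub>m w =
     (if w\<^sub>m \<le> w then \<alpha> * w\<^sub>m powr \<alpha> * w powr (- (\<alpha> + 1)) else 0)"

(* The map W \<mapsto> B, for a fixed realisation W. *)
definition hard_threshold :: "real \<Rightarrow> real ^ 'c ^ 'r \<Rightarrow> real ^ 'c ^ 'r" where
  "hard_threshold \<tau> A = (\<chi> k l. A $ k $ l * indicator {\<tau><..} (A $ k $ l))"

definition num_nonzero :: "real ^ 'c ^ 'r \<Rightarrow> nat" where
  "num_nonzero A = card {(k, l). A $ k $ l \<noteq> 0}"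

definition iid_pareto_matrix ::
    "'a measure \<Rightarrow> real \<Rightarrow> real \<Rightarrow> ('a \<Rightarrow> real ^ 'c ^ 'r) \<Rightarrow> bool" where
  "iid_pareto_matrix M \<alpha> w\<^sub>m W \<longleftrightarrow>
     prob_space.indep_vars M (\<lambda>_. borel) (\<lambda>(k, l) \<omega>. W \<omega> $ k $ l) UNIV \<and>
     (\<forall>k l. distributed M lborel (\<lambda>\<omega>. W \<omega> $ k $ l) (\<lambda>w. ennreal (pareto_density \<alpha> w\<^sub>m w)))"

(* In the bound with k = n, the base (1 - p) / (1 - k / n) is a division by zero; its
   exponent n - k is the natural number 0, so the factor is 1, which is the intended reading. *)

end

theory Submission
  imports Defs
begin

text \<open>
  Compare the entries with a Bernoulli family of success rate \<open>k / n\<close> in place of \<open>p\<close>. The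
  likelihood ratio of the two is \<open>a ^ X * b ^ (n - X)\<close> with \<open>a = k / (n p) \<ge> 1\<close> and
  \<open>b = (1 - k / n) / (1 - p) \<le> 1\<close>. It has expectation 1 by independence and is at least
  \<open>a ^ k * b ^ (n - k)\<close> where \<open>X \<ge> k\<close>, so Markov's inequality gives the bound. Unlike
  exponential tilting, this also covers \<open>k = n\<close>, where \<open>b = 0\<close>.
\<close>

text \<open>Each unit added to \<open>m\<close> trades a factor \<open>b\<close>, at most 1, for a
  factor \<open>a\<close>, at least 1. This gives the pointwise lower bound on the likelihood
  ratio.\<close>

lemma power_mult_power_mono_exchange:
  fixes a b :: "'a :: linordered_idom"
  assumes "1 \<le> a" "0 \<le> b" "b \<le> 1" "k \<le> m" "m \<le> n"
  shows "a ^ k * b ^ (n - k) \<le> a ^ m * b ^ (n - m)"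
  using assms by (intro mult_mono power_increasing power_decreasing) auto

text \<open>Independence turns the expectation of the product into a product of equal means, each of
  a variable with the two values \<open>a\<close> and \<open>b\<close>. Integrability is recorded
  because Markov's inequality asks for it.\<close>

lemma (in prob_space) expectation_prod_two_valued:
  fixes a b p :: real
  assumes fin: "finite I"
    and indep: "indep_vars (\<lambda>_. N) Z I"
    and S: "S \<in> sets N"
    and p: "\<And>i. i \<in> I \<Longrightarrow> prob {\<omega> \<in> space M. Z i \<omega> \<in> S} = p"
  shows "integrable M (\<lambda>\<omega>. \<Prod>i\<in>I. if Z i \<omega> \<in> S then a else b)"
    and "expectation (\<lambda>\<omega>. \<Prod>i\<in>I. if Z i \<omega> \<in> S then a else b) = (a * p + b * (1 - p)) ^ card I"
proof -
  define f where "f i \<omega> = (if Z i \<omega> \<in> S then a else b)" for i \<omega>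
  have f_indep: "indep_vars (\<lambda>_. borel) f I"
    unfolding f_def
    by (rule indep_vars_compose2[OF indep, where Y = "\<lambda>_ x. if x \<in> S then a else b"])
      (use S in measurable)
  have ev: "{\<omega> \<in> space M. Z i \<omega> \<in> S} \<in> events" if "i \<in> I" for i
    proof -
    have [measurable]: "Z i \<in> measurable M N" "S \<in> sets N"
      using indep that S by (auto simp: indep_vars_def)
    show ?thesis by measurable
  qed
  \<comment> \<open>Writing the factor as an affine function of an indicator reduces its
    integrability and mean to linearity.\<close>
  have f_eq: "f i \<omega> = b + (a - b) * indicat_real {\<omega> \<in> space M. Z i \<omega> \<in> S} \<omega>"
    if "\<omega> \<in> space M" for i \<omega>
    using that by (simp add: f_def)
  have ind_int: "integrable M (indicat_real {\<omega> \<in> space M. Z i \<omega> \<in> S})" if "i \<in> I" for i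
    using ev[OF that] by (intro integrable_real_indicator) (simp_all add: less_top[symmetric])
  then have f_int: "integrable M (f i)" if "i \<in> I" for i
    using that by (subst Bochner_Integration.integrable_cong[OF refl f_eq]) simp_all
  have f_exp: "expectation (f i) = a * p + b * (1 - p)" if "i \<in> I" for i
  proof -
    have "expectation (f i)
        = expectation (\<lambda>\<omega>. b + (a - b) * indicat_real {\<omega> \<in> space M. Z i \<omega> \<in> S} \<omega>)"
      by (rule Bochner_Integration.integral_cong[OF refl f_eq])
    also have "\<dots> = b + (a - b) * p"
      using ev[OF that] p[OF that] ind_int[OF that] sets.sets_into_space[OF ev[OF that]]
      by (simp add: prob_space Int_absorb2)
    finally show ?thesis by (simp add: algebra_simps)
  qed
  show "integrable M (\<lambda>\<omega>. \<Prod>i\<in>I. if Z i \<omega> \<in> S then a else b)"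
    using indep_vars_integrable[OF fin f_indep f_int] by (simp add: f_def)
  show "expectation (\<lambda>\<omega>. \<Prod>i\<in>I. if Z i \<omega> \<in> S then a else b) = (a * p + b * (1 - p)) ^ card I"
    using indep_vars_lebesgue_integral[OF fin f_indep f_int] f_exp unfolding f_def by simp
qed

text \<open>The right-hand side is exp(-n D), where n is \<open>card I\<close> and D is the relative
  entropy of Bernoulli(k/n) with respect to Bernoulli(p).\<close>

lemma (in prob_space) Chernoff_count_bound:
  fixes p :: real
  assumes fin: "finite I"
    and indep: "indep_vars (\<lambda>_. N) Z I"
    and S: "S \<in> sets N"
    and p: "\<And>i. i \<in> I \<Longrightarrow> prob {\<omega> \<in> space M. Z i \<omega> \<in> S} = p"
    and "0 < p" and "k \<le> card I" and k: "real (card I) * p < real k"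
  shows "prob {\<omega> \<in> space M. k \<le> card {i \<in> I. Z i \<omega> \<in> S}}
    \<le> (real (card I) * p / real k) ^ k * ((1 - p) / (1 - real k / real (card I))) ^ (card I - k)"
proof -
  define n where "n = card I"
  define a where "a = real k / (real n * p)"
  define b where "b = (1 - real k / real n) / (1 - p)"
  define L where "L \<omega> = (\<Prod>i\<in>I. if Z i \<omega> \<in> S then a else b)" for \<omega>
  define A where "A = {\<omega> \<in> space M. k \<le> card {i \<in> I. Z i \<omega> \<in> S}}"
  have kn: "k \<le> n" and knp: "real n * p < real k"
    using assms by (simp_all add: n_def)
  \<comment> \<open>From 0 \<le> n p < k \<le> n follow k > 0, n > 0 and p < 1, so no denominator in
    \<open>a\<close> or \<open>b\<close> vanishes.\<close>
  have "0 \<le> real n * p" using \<open>0 < p\<close> by simp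
  then have k0: "0 < k" using knp by linarith
  then have n0: "0 < n" using kn by linarith
  have "real n * p < real n * 1" using knp kn by simp
  then have p1: "p < 1" using n0 by (simp only: mult_less_cancel_left_pos of_nat_0_less_iff)
  have a1: "1 \<le> a" using knp n0 \<open>0 < p\<close> by (simp add: a_def)
  have b0: "0 \<le> b" using kn n0 p1 by (simp add: b_def)
  have b1: "b \<le> 1" using knp n0 p1 by (simp add: b_def field_simps)
  \<comment> \<open>The summands are k/n and 1 - k/n, the two probabilities of the comparison
    family.\<close>
  have "a * p + b * (1 - p) = 1"
    using n0 \<open>0 < p\<close> p1 by (simp add: a_def b_def)
  then have L_int: "integrable M L" and L_exp: "expectation L = 1"
    using expectation_prod_two_valued[OF fin indep S p, of a b] by (simp_all add: L_def[abs_def])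
  have L_eq: "L \<omega> = a ^ card {i \<in> I. Z i \<omega> \<in> S} * b ^ (n - card {i \<in> I. Z i \<omega> \<in> S})" for \<omega>
  proof -
    have "{i \<in> I. Z i \<omega> \<notin> S} = I - {i \<in> I. Z i \<omega> \<in> S}" by auto
    then have "card {i \<in> I. Z i \<omega> \<notin> S} = n - card {i \<in> I. Z i \<omega> \<in> S}"
      using fin by (simp add: card_Diff_subset n_def)
    then show ?thesis
      using fin by (simp add: L_def prod.If_cases Int_def)
  qed
  have L_nonneg: "0 \<le> L \<omega>" for \<omega>
    using a1 b0 by (simp add: L_eq)
  have ge: "{\<omega> \<in> space M. a ^ k * b ^ (n - k) \<le> L \<omega>} \<supseteq> A"
    using a1 b0 b1 fin
    by (auto simp: A_def L_eq n_def intro!: power_mult_power_mono_exchange card_mono)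
  \<comment> \<open>For k = n the base \<open>b\<close> is 0, but its exponent is 0 too, so the
    Markov threshold stays positive.\<close>
  have "0 < b" if "k \<noteq> n"
    using that kn n0 p1 by (simp add: b_def)
  then have pos: "0 < a ^ k * b ^ (n - k)"
    using a1 by (cases "k = n") simp_all
  have "prob A \<le> prob {\<omega> \<in> space M. a ^ k * b ^ (n - k) \<le> L \<omega>}"
    using ge borel_measurable_integrable[OF L_int] by (intro finite_measure_mono) measurable
  also have "\<dots> \<le> expectation L / (a ^ k * b ^ (n - k))"
    using L_int pos by (intro integral_Markov_inequality_measure[where A = "{}"])
      (auto simp: L_nonneg)
  also have "\<dots> = (real n * p / real k) ^ k * ((1 - p) / (1 - real k / real n)) ^ (n - k)"
    by (simp add: L_exp a_def b_def power_divide)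
  finally show ?thesis by (simp add: A_def n_def)
qed

text \<open>On the half-line from \<tau> the density is in its nonzero branch and has the
  antiderivative \<open>F\<close>, which tends to 0 at infinity; the integral is therefore
  \<open>- F \<tau>\<close>. The half-line is closed to fit the fundamental theorem used.\<close>

lemma nn_integral_pareto_density_tail:
  assumes "\<alpha> > 0" "w\<^sub>m > 0" "\<tau> \<ge> w\<^sub>m"
  shows "(\<integral>\<^sup>+w. ennreal (pareto_density \<alpha> w\<^sub>m w) * indicator {\<tau>..} w \<partial>lborel)
    = ennreal (w\<^sub>m powr \<alpha> * \<tau> powr (- \<alpha>))"
proof -
  define F where "F w = - (w\<^sub>m powr \<alpha> * w powr (- \<alpha>))" for w
  have "(\<integral>\<^sup>+w. ennreal (pareto_density \<alpha> w\<^sub>m w) * indicator {\<tau>..} w \<partial>lborel) = ennreal (0 - F \<tau>)"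
  proof (rule nn_integral_FTC_atLeast)
    show "pareto_density \<alpha> w\<^sub>m \<in> borel_measurable borel"
      unfolding pareto_density_def by measurable
    show "(F has_real_derivative pareto_density \<alpha> w\<^sub>m w) (at w)" if "\<tau> \<le> w" for w
      using that assms unfolding F_def pareto_density_def
      by (auto intro!: derivative_eq_intros simp: powr_diff powr_minus powr_add field_simps)
    show "0 \<le> pareto_density \<alpha> w\<^sub>m w" for w
      using assms by (simp add: pareto_density_def)
    have "((\<lambda>w. - (w\<^sub>m powr \<alpha> * w powr (- \<alpha>))) \<longlongrightarrow> - (w\<^sub>m powr \<alpha> * 0)) at_top"
      using assms by (intro tendsto_intros tendsto_neg_powr filterlim_ident) auto
    then show "(F \<longlongrightarrow> 0) at_top" by (simp add: F_def[abs_def])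
  qed
  then show ?thesis by (simp add: F_def)
qed

lemma (in prob_space) pareto_tail:
  assumes Z: "distributed M lborel Z (\<lambda>w. ennreal (pareto_density \<alpha> w\<^sub>m w))"
    and "\<alpha> > 0" "w\<^sub>m > 0" "\<tau> \<ge> w\<^sub>m"
  shows "prob {\<omega> \<in> space M. Z \<omega> \<in> {\<tau><..}} = w\<^sub>m powr \<alpha> * \<tau> powr (- \<alpha>)"
proof -
  have "emeasure M {\<omega> \<in> space M. Z \<omega> \<in> {\<tau><..}} = emeasure M (Z -` {\<tau><..} \<inter> space M)"
    by (rule arg_cong[where f = "emeasure M"]) auto
  also have "\<dots> = (\<integral>\<^sup>+w. ennreal (pareto_density \<alpha> w\<^sub>m w) * indicator {\<tau><..} w \<partial>lborel)"
    using Z by (rule distributed_emeasure) simp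
  \<comment> \<open>The open and closed half-lines differ by the Lebesgue-null point \<tau>.\<close>
  also have "\<dots> = (\<integral>\<^sup>+w. ennreal (pareto_density \<alpha> w\<^sub>m w) * indicator {\<tau>..} w \<partial>lborel)"
    using AE_lborel_singleton[of \<tau>]
    by (intro nn_integral_cong_AE, eventually_elim) (auto simp: indicator_def)
  also have "\<dots> = ennreal (w\<^sub>m powr \<alpha> * \<tau> powr (- \<alpha>))"
    using assms by (intro nn_integral_pareto_density_tail)
  finally show ?thesis by (simp add: measure_def)
qed

text \<open>An entry above a nonnegative \<tau> is itself nonzero, so thresholding keeps it nonzero;
  for negative \<tau> a zero entry could exceed \<tau> without being counted.\<close>

lemma num_nonzero_hard_threshold:
  assumes "0 \<le> \<tau>"
  shows "num_nonzero (hard_threshold \<tau> A) = card {(k, l). A $ k $ l \<in> {\<tau><..}}"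
  using assms by (auto simp: num_nonzero_def hard_threshold_def indicator_eq_0_iff
      intro!: arg_cong[where f = card])

theorem proposition1p2:
  fixes M :: "'a measure"
    and W B :: "'a \<Rightarrow> real ^ 'N\<^sub>2 ^ 'N\<^sub>1"
    and X :: "'a \<Rightarrow> nat"
    and \<alpha> w\<^sub>m \<tau> p :: real
    and n k :: nat
  assumes "prob_space M"
    and "\<alpha> > 0" and "w\<^sub>m > 0"
    and "iid_pareto_matrix M \<alpha> w\<^sub>m W"
    and "\<tau> > w\<^sub>m"
    and "B = (\<lambda>\<omega>. hard_threshold \<tau> (W \<omega>))"
    and "n = CARD('N\<^sub>1) * CARD('N\<^sub>2)"
    and "p = w\<^sub>m powr \<alpha> * \<tau> powr (- \<alpha>)"
    and "X = (\<lambda>\<omega>. num_nonzero (B \<omega>))"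
    and "k \<le> n"
    and "real k > real n * p"
  shows "measure M {\<omega> \<in> space M. X \<omega> \<ge> k}
    \<le> (real n * w\<^sub>m powr \<alpha> * \<tau> powr (- \<alpha>) / real k) ^ k
       * ((1 - w\<^sub>m powr \<alpha> * \<tau> powr (- \<alpha>)) / (1 - real k / real n)) ^ (n - k)"
proof -
  interpret prob_space M by fact
  have indep: "indep_vars (\<lambda>_. borel) (\<lambda>(k, l) \<omega>. W \<omega> $ k $ l) UNIV"
    and distr: "\<And>k l. distributed M lborel (\<lambda>\<omega>. W \<omega> $ k $ l)
      (\<lambda>w. ennreal (pareto_density \<alpha> w\<^sub>m w))"
    using assms by (auto simp: iid_pareto_matrix_def)
  have n: "card (UNIV :: ('N\<^sub>1 \<times> 'N\<^sub>2) set) = n"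
    using assms by (simp add: card_cartesian_product flip: UNIV_Times_UNIV)
  \<comment> \<open>The \<open>case\<close> form matches the family in \<open>indep\<close>, indexed
    by pairs, so that the counting bound applies to it directly.\<close>
  have prob: "prob {\<omega> \<in> space M. (case i of (k, l) \<Rightarrow> \<lambda>\<omega>. W \<omega> $ k $ l) \<omega> \<in> {\<tau><..}} = p" for i
    using pareto_tail[OF distr, of \<tau>] assms by (cases i) simp
  have "0 < p" using assms by simp
  then have "prob {\<omega> \<in> space M. k \<le> card {i \<in> UNIV. (case i of (k, l) \<Rightarrow> \<lambda>\<omega>. W \<omega> $ k $ l) \<omega> \<in> {\<tau><..}}}
      \<le> (real n * p / real k) ^ k * ((1 - p) / (1 - real k / real n)) ^ (n - k)"
    using Chernoff_count_bound[OF _ indep _ prob, of k] assms(10,11) unfolding n by auto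
  moreover have "X \<omega> = card {i \<in> UNIV. (case i of (k, l) \<Rightarrow> \<lambda>\<omega>. W \<omega> $ k $ l) \<omega> \<in> {\<tau><..}}" for \<omega>
    using assms by (auto simp: num_nonzero_hard_threshold intro!: arg_cong[where f = card])
  ultimately show ?thesis
    using assms(8) by (simp add: mult.assoc)
qed

end
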